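(* If $n>4$, then the twin group $T_n$ has the following description as a free product with amalgamation: $$T_n\cong\left(\mathbb{Z}_2\times T_{n-2}\right)\,*_{T_{n-3}}\,\left(\mathbb{Z}_2\times T_{n-3}\right).$$
   Context: For an integer $m\ge 2$, the twin group $T_m$ is the group generated by $s_1,\dots,s_{m-1}$ with defining relations $s_i^2=1$ for $1\le i\le m-1$ and $s_is_j=s_js_i$ for $|i-j|\ge 2$. $\mathbb{Z}_2$ is the cyclic group of order 2. $A*_C B$ denotes a free product of groups $A$ and $B$ with amalgamated subgroup $C$. *)

theory Defs
  imports "HOL-Algebra.Elementary_Groups"
begin

text \<open>
  Words over \<open>S\<close> and formal inverses of elements of \<open>S\<close>: the letter \<open>(x, True)\<close> stands for \<open>x\<close>,
  the letter \<open>(x, False)\<close> for its inverse.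
\<close>

type_synonym 'a word = "('a \<times> bool) list"

abbreviation gen :: "'a \<Rightarrow> 'a \<times> bool" where
  "gen x \<equiv> (x, True)"

abbreviation words_on :: "'a set \<Rightarrow> 'a word set" where
  "words_on S \<equiv> lists (S \<times> UNIV)"

text \<open>
  The group with generators \<open>S\<close> and defining relations \<open>R\<close>, where a pair \<open>(u, v) \<in> R\<close> is the
  relation \<open>u = v\<close>: words modulo the least congruence that contains \<open>R\<close> and makes \<open>(x, True)\<close>
  and \<open>(x, False)\<close> mutually inverse.
\<close>

inductive pres_eq :: "'a set \<Rightarrow> ('a word \<times> 'a word) set \<Rightarrow> 'a word \<Rightarrow> 'a word \<Rightarrow> bool"
  for S R where
  refl: "w \<in> words_on S \<Longrightarrow> pres_eq S R w w"
| sym: "pres_eq S R u v \<Longrightarrow> pres_eq S R v u"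
| trans: "pres_eq S R u v \<Longrightarrow> pres_eq S R v w \<Longrightarrow> pres_eq S R u w"
| append: "pres_eq S R u v \<Longrightarrow> pres_eq S R u' v' \<Longrightarrow> pres_eq S R (u @ u') (v @ v')"
| cancel: "x \<in> S \<Longrightarrow> pres_eq S R [(x, b), (x, \<not> b)] []"
| relation: "(u, v) \<in> R \<Longrightarrow> u \<in> words_on S \<Longrightarrow> v \<in> words_on S \<Longrightarrow> pres_eq S R u v"

definition presented_group :: "'a set \<Rightarrow> ('a word \<times> 'a word) set \<Rightarrow> 'a word set monoid" where
  "presented_group S R =
     \<lparr>carrier = words_on S // {(u, v). pres_eq S R u v},
      mult = (\<lambda>X Y. {w. \<exists>u\<in>X. \<exists>v\<in>Y. pres_eq S R (u @ v) w}),
      one = {w. pres_eq S R [] w}\<rparr>"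

lemma pres_eq_words:
  assumes "pres_eq S R u v"
  shows "u \<in> words_on S \<and> v \<in> words_on S"
  using assms by induction auto

lemma pres_eq_equiv: "equiv (words_on S) {(u, v). pres_eq S R u v}"
  by (rule equivI)
    (auto simp: refl_on_def sym_def trans_def dest: pres_eq_words intro: pres_eq.intros)

lemma presented_group_carrierE:
  assumes "X \<in> carrier (presented_group S R)"
  obtains u where "u \<in> words_on S" "X = {w. pres_eq S R u w}"
  using assms by (auto simp: presented_group_def elim!: quotientE)

lemma presented_group_carrierI:
  "u \<in> words_on S \<Longrightarrow> {w. pres_eq S R u w} \<in> carrier (presented_group S R)"
  by (auto simp: presented_group_def quotient_def)

lemma presented_group_mult:
  assumes "u \<in> words_on S" "v \<in> words_on S"
  shows "{w. pres_eq S R u w} \<otimes>\<^bsub>presented_group S R\<^esub> {w. pres_eq S R v w} =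
         {w. pres_eq S R (u @ v) w}"
  using assms
  by (auto simp: presented_group_def
      intro: pres_eq.refl pres_eq.trans[OF pres_eq.append])

lemma pres_eq_inverse:
  "u \<in> words_on S \<Longrightarrow> pres_eq S R (rev (map (\<lambda>(x, b). (x, \<not> b)) u) @ u) []"
proof (induction u)
  case Nil
  then show ?case by (simp add: pres_eq.refl)
next
  case (Cons a u)
  obtain x b where a: "a = (x, b)" by force
  let ?r = "rev (map (\<lambda>(x, b). (x, \<not> b)) u)"
  have r: "?r \<in> words_on S" and u: "u \<in> words_on S" and x: "x \<in> S"
    using Cons.prems a by auto
  have "pres_eq S R ([(x, \<not> b), (x, b)] @ u) ([] @ u)"
    using pres_eq.cancel[OF x, of R "\<not> b"] u by (intro pres_eq.append pres_eq.refl) auto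
  then have "pres_eq S R (?r @ [(x, \<not> b), (x, b)] @ u) (?r @ [] @ u)"
    using r by (simp add: pres_eq.append pres_eq.refl)
  then show ?case
    using Cons.IH[OF u] a by (auto intro: pres_eq.trans)
qed

lemma group_presented_group: "group (presented_group S R)"
proof (rule groupI)
  have one: "\<one>\<^bsub>presented_group S R\<^esub> = {w. pres_eq S R [] w}"
    by (simp add: presented_group_def)
  show "\<one>\<^bsub>presented_group S R\<^esub> \<in> carrier (presented_group S R)"
    unfolding one by (rule presented_group_carrierI) simp
  fix X assume "X \<in> carrier (presented_group S R)"
  then obtain u where u: "u \<in> words_on S" and X: "X = {w. pres_eq S R u w}"
    by (rule presented_group_carrierE)
  show "\<one>\<^bsub>presented_group S R\<^esub> \<otimes>\<^bsub>presented_group S R\<^esub> X = X"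
    unfolding one X using u by (simp add: presented_group_mult)
  let ?r = "rev (map (\<lambda>(x, b). (x, \<not> b)) u)"
  have r: "?r \<in> words_on S" using u by auto
  have "{w. pres_eq S R ?r w} \<otimes>\<^bsub>presented_group S R\<^esub> X = \<one>\<^bsub>presented_group S R\<^esub>"
    unfolding one X presented_group_mult[OF r u]
    using pres_eq_inverse[OF u] by (blast intro: pres_eq.trans pres_eq.sym)
  then show "\<exists>Y\<in>carrier (presented_group S R).
      Y \<otimes>\<^bsub>presented_group S R\<^esub> X = \<one>\<^bsub>presented_group S R\<^esub>"
    using presented_group_carrierI[OF r] by blast
  fix Y assume "Y \<in> carrier (presented_group S R)"
  then obtain v where v: "v \<in> words_on S" and Y: "Y = {w. pres_eq S R v w}"
    by (rule presented_group_carrierE)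
  have uv: "u @ v \<in> words_on S" using u v by simp
  show "X \<otimes>\<^bsub>presented_group S R\<^esub> Y \<in> carrier (presented_group S R)"
    unfolding X Y presented_group_mult[OF u v] by (rule presented_group_carrierI[OF uv])
  fix Z assume "Z \<in> carrier (presented_group S R)"
  then obtain z where z: "z \<in> words_on S" and Z: "Z = {w. pres_eq S R z w}"
    by (rule presented_group_carrierE)
  have vz: "v @ z \<in> words_on S" using v z by simp
  show "X \<otimes>\<^bsub>presented_group S R\<^esub> Y \<otimes>\<^bsub>presented_group S R\<^esub> Z =
        X \<otimes>\<^bsub>presented_group S R\<^esub> (Y \<otimes>\<^bsub>presented_group S R\<^esub> Z)"
    unfolding X Y Z presented_group_mult[OF u v] presented_group_mult[OF v z]
      presented_group_mult[OF uv z] presented_group_mult[OF u vz] by simp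
qed

definition twin_relations :: "nat \<Rightarrow> (nat word \<times> nat word) set" where
  "twin_relations m =
     {([gen i, gen i], []) | i. i \<in> {1..m - 1}} \<union>
     {([gen i, gen j], [gen j, gen i]) | i j.
        i \<in> {1..m - 1} \<and> j \<in> {1..m - 1} \<and> \<bar>int i - int j\<bar> \<ge> 2}"

definition twin_group :: "nat \<Rightarrow> nat word set monoid" where
  "twin_group m = presented_group {1..m - 1} (twin_relations m)"

text \<open>
  The standard homomorphism from \<open>twin_group k\<close> to \<open>twin_group m\<close> for \<open>k \<le> m\<close>, sending each
  generator to the generator with the same index: the class of a word is sent to the class of
  the same word.
\<close>

definition twin_incl :: "nat \<Rightarrow> nat word set \<Rightarrow> nat word set" where
  "twin_incl m X = {w. \<exists>u\<in>X. pres_eq {1..m - 1} (twin_relations m) u w}"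

text \<open>
  The free product of \<open>A\<close> and \<open>B\<close> amalgamated along \<open>f : C \<rightarrow> A\<close> and \<open>g : C \<rightarrow> B\<close>: the elements
  of both groups are the generators, and the relations are the multiplication tables of \<open>A\<close> and
  \<open>B\<close> together with \<open>f c = g c\<close> for \<open>c\<close> in \<open>C\<close>. It deserves its name only if \<open>f\<close> and \<open>g\<close> are
  injective homomorphisms, which has to be established separately.
\<close>

definition amalgamated_product ::
  "('a, 'm) monoid_scheme \<Rightarrow> ('b, 'n) monoid_scheme \<Rightarrow> ('c, 'k) monoid_scheme \<Rightarrow>
   ('c \<Rightarrow> 'a) \<Rightarrow> ('c \<Rightarrow> 'b) \<Rightarrow> ('a + 'b) word set monoid" where
  "amalgamated_product A B C f g =
     presented_group (carrier A <+> carrier B)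
       ({([gen (Inl a), gen (Inl a')], [gen (Inl (a \<otimes>\<^bsub>A\<^esub> a'))]) | a a'.
           a \<in> carrier A \<and> a' \<in> carrier A} \<union>
        {([gen (Inr b), gen (Inr b')], [gen (Inr (b \<otimes>\<^bsub>B\<^esub> b'))]) | b b'.
           b \<in> carrier B \<and> b' \<in> carrier B} \<union>
        {([gen (Inl (f c))], [gen (Inr (g c))]) | c. c \<in> carrier C})"

abbreviation Z2 :: "int monoid" where
  "Z2 \<equiv> integer_mod_group 2"

end

theory Submission
  imports Defs
begin

text \<open>
  In \<open>T\<^sub>n\<close> the generators \<open>s\<^sub>1, \<dots>, s\<^sub>n\<^sub>-\<^sub>3, s\<^sub>n\<^sub>-\<^sub>1\<close> satisfy the relations of \<open>Z\<^sub>2 \<times> T\<^sub>n\<^sub>-\<^sub>2\<close>, with \<open>Z\<^sub>2\<close>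
  generated by \<open>s\<^sub>n\<^sub>-\<^sub>1\<close>, and \<open>s\<^sub>1, \<dots>, s\<^sub>n\<^sub>-\<^sub>4, s\<^sub>n\<^sub>-\<^sub>2\<close> those of \<open>Z\<^sub>2 \<times> T\<^sub>n\<^sub>-\<^sub>3\<close>, with \<open>Z\<^sub>2\<close> generated by
  \<open>s\<^sub>n\<^sub>-\<^sub>2\<close>. Every defining relation of \<open>T\<^sub>n\<close> is of one of these two kinds, because \<open>s\<^sub>n\<^sub>-\<^sub>2\<close> has no
  relation with \<open>s\<^sub>n\<^sub>-\<^sub>3\<close> or \<open>s\<^sub>n\<^sub>-\<^sub>1\<close>; so both groups have the same presentation. The standard map
  \<open>T\<^sub>k \<rightarrow> T\<^sub>m\<close> is injective since killing the generators of index at least \<open>k\<close> is a retraction.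
\<close>

section \<open>Presented groups: classes of words, and induction on generators\<close>

definition word_class :: "'a set \<Rightarrow> ('a word \<times> 'a word) set \<Rightarrow> 'a word \<Rightarrow> 'a word set" where
  "word_class S R u = {w. pres_eq S R u w}"

text \<open>A word over \<open>S\<close> lies in its own class, hence in that of \<open>v\<close>
  when the classes agree. The assumption on \<open>u\<close> matters: \<open>pres_eq\<close> relates
  only words over \<open>S\<close>, so all other words share the empty class.\<close>

lemma word_class_eq_iff:
  assumes "u \<in> words_on S"
  shows "word_class S R u = word_class S R v \<longleftrightarrow> pres_eq S R u v"
proof
  assume "word_class S R u = word_class S R v"
  with pres_eq.refl[OF assms, of R] have "pres_eq S R v u"
    by (auto simp: word_class_def)
  then show "pres_eq S R u v"
    by (rule pres_eq.sym)
qed (auto simp: word_class_def intro: pres_eq.sym pres_eq.trans)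

lemma word_class_in_carrier:
  "u \<in> words_on S \<Longrightarrow> word_class S R u \<in> carrier (presented_group S R)"
  unfolding word_class_def by (rule presented_group_carrierI)

lemma word_class_append:
  "u \<in> words_on S \<Longrightarrow> v \<in> words_on S \<Longrightarrow>
   word_class S R (u @ v) = word_class S R u \<otimes>\<^bsub>presented_group S R\<^esub> word_class S R v"
  unfolding word_class_def by (simp add: presented_group_mult)

lemma word_class_pair:
  "fst l \<in> S \<Longrightarrow> fst l' \<in> S \<Longrightarrow>
   word_class S R [l, l'] = word_class S R [l] \<otimes>\<^bsub>presented_group S R\<^esub> word_class S R [l']"
  using word_class_append[of "[l]" S "[l']" R] by (auto simp: mem_Times_iff)

lemma word_class_Nil: "word_class S R [] = \<one>\<^bsub>presented_group S R\<^esub>"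
  by (simp add: word_class_def presented_group_def)

lemma word_class_inverse_letter:
  assumes "x \<in> S"
  shows "word_class S R [(x, False)] = inv\<^bsub>presented_group S R\<^esub> word_class S R [gen x]"
proof -
  interpret group "presented_group S R" by (rule group_presented_group)
  have "word_class S R [(x, False)] \<otimes>\<^bsub>presented_group S R\<^esub> word_class S R [gen x]
      = word_class S R [(x, False), gen x]"
    using assms by (simp add: word_class_pair)
  also have "\<dots> = \<one>\<^bsub>presented_group S R\<^esub>"
    using assms pres_eq.cancel[of x S R False] by (simp add: word_class_eq_iff flip: word_class_Nil)
  finally show ?thesis
    using assms by (intro inv_equality[symmetric]) (auto intro: word_class_in_carrier)
qed

text \<open>A representing word is taken apart letter by letter. The case \<open>inv\<close>
  accounts for the letters \<open>(x, False)\<close>, whose classes are inverses of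
  generators.\<close>

lemma presented_group_induct [consumes 1, case_names one mult inv gen]:
  assumes "X \<in> carrier (presented_group S R)"
    and one: "P \<one>\<^bsub>presented_group S R\<^esub>"
    and mult: "\<And>X Y. X \<in> carrier (presented_group S R) \<Longrightarrow> Y \<in> carrier (presented_group S R) \<Longrightarrow>
      P X \<Longrightarrow> P Y \<Longrightarrow> P (X \<otimes>\<^bsub>presented_group S R\<^esub> Y)"
    and inv: "\<And>X. X \<in> carrier (presented_group S R) \<Longrightarrow> P X \<Longrightarrow> P (inv\<^bsub>presented_group S R\<^esub> X)"
    and gen: "\<And>x. x \<in> S \<Longrightarrow> P (word_class S R [gen x])"
  shows "P X"
proof -
  have "u \<in> words_on S \<Longrightarrow> P (word_class S R u)" for u
  proof (induction u)
    case Nil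
    then show ?case by (simp add: word_class_Nil one)
  next
    case (Cons a u)
    obtain x b where a: "a = (x, b)" by force
    from Cons.prems have x: "x \<in> S" and u: "u \<in> words_on S" by (simp_all add: a)
    have "word_class S R [gen x] \<in> carrier (presented_group S R)"
      using x by (intro word_class_in_carrier) simp
    then have "P (word_class S R [a])"
      using inv gen[OF x] x by (cases b) (simp_all add: a word_class_inverse_letter)
    moreover have "word_class S R (a # u)
        = word_class S R [a] \<otimes>\<^bsub>presented_group S R\<^esub> word_class S R u"
      using x u a by (simp flip: word_class_append)
    ultimately show ?case
      using Cons.IH[OF u] x u a by (auto intro!: mult word_class_in_carrier)
  qed
  then show ?thesis
    using assms(1) by (auto simp: word_class_def elim!: presented_group_carrierE)
qed

text \<open>The elements on which two homomorphisms agree form a subgroup, here one that contains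
  every generator.\<close>

lemma presented_group_hom_eqI:
  assumes "group G" "\<phi> \<in> hom (presented_group S R) G" "\<psi> \<in> hom (presented_group S R) G"
    and "\<And>x. x \<in> S \<Longrightarrow> \<phi> (word_class S R [gen x]) = \<psi> (word_class S R [gen x])"
    and "X \<in> carrier (presented_group S R)"
  shows "\<phi> X = \<psi> X"
proof -
  interpret \<phi>: group_hom "presented_group S R" G \<phi>
    using assms group_presented_group by (auto simp: group_hom_def group_hom_axioms_def)
  interpret \<psi>: group_hom "presented_group S R" G \<psi>
    using assms group_presented_group by (auto simp: group_hom_def group_hom_axioms_def)
  show ?thesis
    using assms(5) by (induction rule: presented_group_induct) (auto simp: assms(4))
qed

text \<open>The elements whose image commutes with \<open>t\<close> form a subgroup, so testing the
  generators is enough.\<close>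

lemma presented_group_hom_commute:
  assumes "group G" "\<phi> \<in> hom (presented_group S R) G" "t \<in> carrier G"
    and gen: "\<And>x. x \<in> S \<Longrightarrow>
      t \<otimes>\<^bsub>G\<^esub> \<phi> (word_class S R [gen x]) = \<phi> (word_class S R [gen x]) \<otimes>\<^bsub>G\<^esub> t"
    and "X \<in> carrier (presented_group S R)"
  shows "t \<otimes>\<^bsub>G\<^esub> \<phi> X = \<phi> X \<otimes>\<^bsub>G\<^esub> t"
proof -
  interpret \<phi>: group_hom "presented_group S R" G \<phi>
    using assms group_presented_group by (auto simp: group_hom_def group_hom_axioms_def)
  note t = \<open>t \<in> carrier G\<close>
  show ?thesis
    using assms(5)
  proof (induction rule: presented_group_induct)
    case (mult X Y)
    have "t \<otimes>\<^bsub>G\<^esub> \<phi> (X \<otimes>\<^bsub>presented_group S R\<^esub> Y) = t \<otimes>\<^bsub>G\<^esub> \<phi> X \<otimes>\<^bsub>G\<^esub> \<phi> Y"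
      using t mult.hyps by (simp add: \<phi>.H.m_assoc)
    also have "\<dots> = \<phi> X \<otimes>\<^bsub>G\<^esub> (t \<otimes>\<^bsub>G\<^esub> \<phi> Y)"
      unfolding mult.IH(1) using t mult.hyps by (simp add: \<phi>.H.m_assoc)
    also have "\<dots> = \<phi> (X \<otimes>\<^bsub>presented_group S R\<^esub> Y) \<otimes>\<^bsub>G\<^esub> t"
      unfolding mult.IH(2) using t mult.hyps by (simp add: \<phi>.H.m_assoc)
    finally show ?case .
  next
    case (inv X)
    \<comment> \<open>Multiplied by \<open>\<phi> X\<close> from the left, both sides of the goal
      become \<open>t\<close>; then \<open>\<phi> X\<close> is cancelled.\<close>
    then have "\<phi> X \<otimes>\<^bsub>G\<^esub> (inv\<^bsub>G\<^esub> \<phi> X \<otimes>\<^bsub>G\<^esub> t) = \<phi> X \<otimes>\<^bsub>G\<^esub> (t \<otimes>\<^bsub>G\<^esub> inv\<^bsub>G\<^esub> \<phi> X)"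
      using t by (simp flip: \<phi>.H.m_assoc) (simp add: \<phi>.H.m_assoc flip: inv.IH)
    then show ?case
      using t inv by simp
  qed (use t gen in auto)
qed

section \<open>Evaluation of words in a group, and homomorphisms defined by it\<close>

fun word_eval :: "('b, 'm) monoid_scheme \<Rightarrow> ('a \<Rightarrow> 'b) \<Rightarrow> 'a word \<Rightarrow> 'b" where
  "word_eval G h [] = \<one>\<^bsub>G\<^esub>"
| "word_eval G h ((x, b) # u) = (if b then h x else inv\<^bsub>G\<^esub> h x) \<otimes>\<^bsub>G\<^esub> word_eval G h u"

context group
begin

lemma word_eval_closed:
  "h \<in> S \<rightarrow> carrier G \<Longrightarrow> u \<in> words_on S \<Longrightarrow> word_eval G h u \<in> carrier G"
  by (induction u) (auto simp: Pi_iff)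

lemma word_eval_append:
  assumes "h \<in> S \<rightarrow> carrier G" "u \<in> words_on S" "v \<in> words_on S"
  shows "word_eval G h (u @ v) = word_eval G h u \<otimes> word_eval G h v"
  using assms(2)
proof (induction u)
  case (Cons l u)
  then show ?case
    using assms(1) word_eval_closed[OF assms(1)] assms(3) by (cases l) (auto simp: m_assoc Pi_iff)
qed (simp add: word_eval_closed[OF assms(1,3)])

text \<open>Every closure rule of the congruence is respected: \<open>append\<close> because
  evaluation is multiplicative on words over \<open>S\<close>, \<open>cancel\<close> because a
  \<open>False\<close> letter evaluates to an inverse, \<open>relation\<close> by
  assumption.\<close>

lemma word_eval_pres_eq:
  assumes h: "h \<in> S \<rightarrow> carrier G"
    and rel: "\<And>u v. (u, v) \<in> R \<Longrightarrow> u \<in> words_on S \<Longrightarrow> v \<in> words_on S \<Longrightarrow>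
      word_eval G h u = word_eval G h v"
    and "pres_eq S R u v"
  shows "word_eval G h u = word_eval G h v"
  using assms(3)
proof induction
  case (append u v u' v')
  then show ?case
    using pres_eq_words[OF append.hyps(1)] pres_eq_words[OF append.hyps(2)]
    by (simp add: word_eval_append[OF h])
next
  case (cancel x b)
  then show ?case using h by (cases b) (auto simp: Pi_iff)
qed (auto simp: rel)

text \<open>Von Dyck's theorem, the source of all homomorphisms out of presented groups
  below.\<close>

lemma presented_group_universal:
  assumes h: "h \<in> S \<rightarrow> carrier G"
    and rel: "\<And>u v. (u, v) \<in> R \<Longrightarrow> u \<in> words_on S \<Longrightarrow> v \<in> words_on S \<Longrightarrow>
      word_eval G h u = word_eval G h v"
  obtains \<phi> where "\<phi> \<in> hom (presented_group S R) G"
    and "\<And>x. x \<in> S \<Longrightarrow> \<phi> (word_class S R [gen x]) = h x"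
proof
  \<comment> \<open>A class is evaluated at an arbitrarily chosen representative;
    \<open>word_eval_pres_eq\<close> shows that the choice does not affect the value.\<close>
  define \<phi> where "\<phi> X = word_eval G h (SOME u. u \<in> X)" for X
  have \<phi>: "\<phi> (word_class S R u) = word_eval G h u" if "u \<in> words_on S" for u
  proof -
    have "(SOME w. w \<in> word_class S R u) \<in> word_class S R u"
      using pres_eq.refl[OF that] by (intro someI) (auto simp: word_class_def)
    then show ?thesis
      using word_eval_pres_eq[OF h rel] by (auto simp: \<phi>_def word_class_def)
  qed
  show "\<phi> (word_class S R [gen x]) = h x" if "x \<in> S" for x
    using that h by (auto simp: \<phi> Pi_iff)
  show "\<phi> \<in> hom (presented_group S R) G"
  proof (rule homI)
    fix X assume "X \<in> carrier (presented_group S R)"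
    then obtain u where u: "u \<in> words_on S" and X: "X = word_class S R u"
      unfolding word_class_def by (rule presented_group_carrierE)
    show "\<phi> X \<in> carrier G"
      using u by (simp add: X \<phi> word_eval_closed[OF h])
    fix Y assume "Y \<in> carrier (presented_group S R)"
    then obtain v where v: "v \<in> words_on S" and Y: "Y = word_class S R v"
      unfolding word_class_def by (rule presented_group_carrierE)
    show "\<phi> (X \<otimes>\<^bsub>presented_group S R\<^esub> Y) = \<phi> X \<otimes> \<phi> Y"
      using u v \<phi>[of "u @ v"] by (simp add: X Y \<phi> word_eval_append[OF h] word_class_append)
  qed
qed

text \<open>The conditional is the power of \<open>t\<close> with exponent \<open>a\<close> in
  \<open>{0, 1}\<close>. Multiplicativity needs \<open>t\<close> to pass \<open>\<beta> x\<close>,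
  and needs \<open>t \<otimes> t = \<one>\<close> where exponents 1 and 1 add up to 0.\<close>

lemma hom_Z2_DirProd:
  assumes "t \<in> carrier G" "t \<otimes> t = \<one>" "\<beta> \<in> hom K G"
    and comm: "\<And>x. x \<in> carrier K \<Longrightarrow> t \<otimes> \<beta> x = \<beta> x \<otimes> t"
  shows "(\<lambda>(a, x). (if a = 0 then \<one> else t) \<otimes> \<beta> x) \<in> hom (Z2 \<times>\<times> K) G"
proof (rule homI)
  have carr: "carrier Z2 = {0, 1}"
    by (auto simp: carrier_integer_mod_group)
  have \<beta>: "\<beta> x \<in> carrier G" "\<beta> (x \<otimes>\<^bsub>K\<^esub> y) = \<beta> x \<otimes> \<beta> y"
    if "x \<in> carrier K" "y \<in> carrier K" for x y
    using assms(3) that by (auto simp: hom_def)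
  fix p assume p: "p \<in> carrier (Z2 \<times>\<times> K)"
  then show "(case p of (a, x) \<Rightarrow> (if a = 0 then \<one> else t) \<otimes> \<beta> x) \<in> carrier G"
    using assms(1) \<beta> by auto
  fix q assume q: "q \<in> carrier (Z2 \<times>\<times> K)"
  obtain a x b y where pq: "p = (a, x)" "q = (b, y)" by force
  have x: "x \<in> carrier K" and y: "y \<in> carrier K" and ab: "a \<in> {0, 1}" "b \<in> {0, 1}"
    using p q carr by (auto simp: pq)
  note bx = \<beta>(1)[OF x x] and bY = \<beta>(1)[OF y y]
  have 1: "\<beta> x \<otimes> (t \<otimes> \<beta> y) = t \<otimes> (\<beta> x \<otimes> \<beta> y)"
    using bx bY assms(1) comm[OF x] by (simp flip: m_assoc)
  have 2: "t \<otimes> (t \<otimes> z) = z" if "z \<in> carrier G" for z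
    using that assms(1,2) by (simp flip: m_assoc)
  show "(case p \<otimes>\<^bsub>Z2 \<times>\<times> K\<^esub> q of (a, x) \<Rightarrow> (if a = 0 then \<one> else t) \<otimes> \<beta> x) =
      (case p of (a, x) \<Rightarrow> (if a = 0 then \<one> else t) \<otimes> \<beta> x) \<otimes>
      (case q of (a, x) \<Rightarrow> (if a = 0 then \<one> else t) \<otimes> \<beta> x)"
    using ab bx bY assms(1) \<beta>(2)[OF x y]
    by (auto simp: pq mult_integer_mod_group m_assoc 1 2)
qed

end

section \<open>The amalgamated product as a pushout of groups\<close>

locale amalgam = A: group A + B: group B
  for A :: "('a, 'm) monoid_scheme" and B :: "('b, 'n) monoid_scheme" +
  fixes C :: "('c, 'k) monoid_scheme" and f g
  assumes f: "f \<in> hom C A" and g: "g \<in> hom C B"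
begin

text \<open>This set and \<open>relations\<close> name the two ingredients of
  \<open>amalgamated_product\<close>, so that \<open>D_eq\<close> makes the results on presented
  groups applicable.\<close>

definition generators :: "('a + 'b) set" where
  "generators = carrier A <+> carrier B"

lemma generators_simps [simp]:
  "Inl a \<in> generators \<longleftrightarrow> a \<in> carrier A" "Inr b \<in> generators \<longleftrightarrow> b \<in> carrier B"
  by (auto simp: generators_def)

definition relations :: "(('a + 'b) word \<times> ('a + 'b) word) set" where
  "relations =
     {([gen (Inl a), gen (Inl a')], [gen (Inl (a \<otimes>\<^bsub>A\<^esub> a'))]) | a a'.
        a \<in> carrier A \<and> a' \<in> carrier A} \<union>
     {([gen (Inr b), gen (Inr b')], [gen (Inr (b \<otimes>\<^bsub>B\<^esub> b'))]) | b b'.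
        b \<in> carrier B \<and> b' \<in> carrier B} \<union>
     {([gen (Inl (f c))], [gen (Inr (g c))]) | c. c \<in> carrier C}"

abbreviation D :: "('a + 'b) word set monoid" where
  "D \<equiv> amalgamated_product A B C f g"

definition inl :: "'a \<Rightarrow> ('a + 'b) word set" where
  "inl a = word_class generators relations [gen (Inl a)]"

definition inr :: "'b \<Rightarrow> ('a + 'b) word set" where
  "inr b = word_class generators relations [gen (Inr b)]"

lemma D_eq: "D = presented_group generators relations"
  by (simp add: amalgamated_product_def generators_def relations_def)

lemma group_D: "group D"
  unfolding D_eq by (rule group_presented_group)

lemma f_closed: "c \<in> carrier C \<Longrightarrow> f c \<in> carrier A"
  and g_closed: "c \<in> carrier C \<Longrightarrow> g c \<in> carrier B"
  using f g by (auto simp: hom_def)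

lemma relations_imp_eq:
  "(u, v) \<in> relations \<Longrightarrow> u \<in> words_on generators \<Longrightarrow> v \<in> words_on generators \<Longrightarrow>
   word_class generators relations u = word_class generators relations v"
  by (simp add: word_class_eq_iff pres_eq.relation)

lemma inl_hom: "inl \<in> hom A D"
proof (rule homI)
  show "inl a \<in> carrier D" if "a \<in> carrier A" for a
    using that by (auto simp: inl_def D_eq intro: word_class_in_carrier)
  fix a a' assume a: "a \<in> carrier A" "a' \<in> carrier A"
  then have "word_class generators relations [gen (Inl a), gen (Inl a')] = inl (a \<otimes>\<^bsub>A\<^esub> a')"
    unfolding inl_def by (intro relations_imp_eq) (auto simp: relations_def)
  with a show "inl (a \<otimes>\<^bsub>A\<^esub> a') = inl a \<otimes>\<^bsub>D\<^esub> inl a'"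
    by (simp add: word_class_pair inl_def D_eq)
qed

lemma inr_hom: "inr \<in> hom B D"
proof (rule homI)
  show "inr b \<in> carrier D" if "b \<in> carrier B" for b
    using that by (auto simp: inr_def D_eq intro: word_class_in_carrier)
  fix b b' assume b: "b \<in> carrier B" "b' \<in> carrier B"
  then have "word_class generators relations [gen (Inr b), gen (Inr b')] = inr (b \<otimes>\<^bsub>B\<^esub> b')"
    unfolding inr_def by (intro relations_imp_eq) (auto simp: relations_def)
  with b show "inr (b \<otimes>\<^bsub>B\<^esub> b') = inr b \<otimes>\<^bsub>D\<^esub> inr b'"
    by (simp add: word_class_pair inr_def D_eq)
qed

lemma inl_f_eq_inr_g:
  assumes "c \<in> carrier C"
  shows "inl (f c) = inr (g c)"
  unfolding inl_def inr_def using assms f_closed[OF assms] g_closed[OF assms]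
  by (intro relations_imp_eq) (auto simp: relations_def)

text \<open>Existence half of the pushout property. Von Dyck's theorem is applied to
  \<open>case_sum \<alpha> \<beta>\<close>: the multiplication tables hold in \<open>G\<close>
  because \<open>\<alpha>\<close> and \<open>\<beta>\<close> are homomorphisms, the gluing relations
  because of \<open>eq\<close>.\<close>

lemma universal:
  assumes "group G" and \<alpha>: "\<alpha> \<in> hom A G" and \<beta>: "\<beta> \<in> hom B G"
    and eq: "\<And>c. c \<in> carrier C \<Longrightarrow> \<alpha> (f c) = \<beta> (g c)"
  obtains \<theta> where "\<theta> \<in> hom D G"
    and "\<And>a. a \<in> carrier A \<Longrightarrow> \<theta> (inl a) = \<alpha> a"
    and "\<And>b. b \<in> carrier B \<Longrightarrow> \<theta> (inr b) = \<beta> b"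
proof -
  interpret G: group G by fact
  have \<alpha>_closed: "\<alpha> a \<in> carrier G" if "a \<in> carrier A" for a
    using \<alpha> that by (auto simp: hom_def)
  have \<beta>_closed: "\<beta> b \<in> carrier G" if "b \<in> carrier B" for b
    using \<beta> that by (auto simp: hom_def)
  have h: "case_sum \<alpha> \<beta> \<in> generators \<rightarrow> carrier G"
    by (auto simp: generators_def \<alpha>_closed \<beta>_closed)
  have rel: "word_eval G (case_sum \<alpha> \<beta>) u = word_eval G (case_sum \<alpha> \<beta>) v"
    if "(u, v) \<in> relations" for u v
    using that \<alpha>_closed \<beta>_closed f_closed g_closed eq
    by (auto simp: relations_def hom_mult[OF \<alpha>] hom_mult[OF \<beta>])
  obtain \<theta> where "\<theta> \<in> hom D G"
    and "\<And>x. x \<in> generators \<Longrightarrow> \<theta> (word_class generators relations [gen x]) = case_sum \<alpha> \<beta> x"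
    unfolding D_eq using G.presented_group_universal[OF h rel] by blast
  then show thesis
    by (intro that[of \<theta>]) (auto simp: inl_def inr_def)
qed

text \<open>Uniqueness half of the pushout property: the images of the two factors contain all
  generators.\<close>

lemma hom_eqI:
  assumes "group G" "\<phi> \<in> hom D G" "\<psi> \<in> hom D G"
    and "\<And>a. a \<in> carrier A \<Longrightarrow> \<phi> (inl a) = \<psi> (inl a)"
    and "\<And>b. b \<in> carrier B \<Longrightarrow> \<phi> (inr b) = \<psi> (inr b)"
    and "X \<in> carrier D"
  shows "\<phi> X = \<psi> X"
proof (rule presented_group_hom_eqI[OF assms(1)])
  show "\<phi> (word_class generators relations [gen x]) = \<psi> (word_class generators relations [gen x])"
    if "x \<in> generators" for x
    using that assms(4,5) by (auto simp: generators_def inl_def inr_def)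
qed (use assms in \<open>simp_all flip: D_eq\<close>)

end

section \<open>Comparing presentations: adding and deleting generators\<close>

lemma words_on_mono: "S \<subseteq> T \<Longrightarrow> words_on S \<subseteq> words_on T"
  by (intro lists_mono Sigma_mono) auto

lemma pres_eq_mono:
  assumes "pres_eq S R u v" "S \<subseteq> S'" "R \<subseteq> R'"
  shows "pres_eq S' R' u v"
  using assms(1)
proof induction
  case (refl w)
  with words_on_mono[OF assms(2)] show ?case by (blast intro: pres_eq.refl)
next
  case (cancel x b)
  with assms show ?case by (auto intro: pres_eq.cancel)
next
  case (relation u v)
  with words_on_mono[OF assms(2)] assms(3) show ?case by (blast intro: pres_eq.relation)
qed (auto intro: pres_eq.sym pres_eq.trans pres_eq.append)

text \<open>Deleting all letters outside \<open>S'\<close> is compatible with concatenation, and a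
  cancelling pair is kept or deleted as a whole. Hence only the relations in \<open>R\<close> have
  to be checked. This is the retraction behind injectivity of \<open>twin_incl\<close>.\<close>

lemma pres_eq_filter:
  assumes "pres_eq S R u v"
    and rel: "\<And>u v. (u, v) \<in> R \<Longrightarrow>
      pres_eq S' R' (filter (\<lambda>l. fst l \<in> S') u) (filter (\<lambda>l. fst l \<in> S') v)"
  shows "pres_eq S' R' (filter (\<lambda>l. fst l \<in> S') u) (filter (\<lambda>l. fst l \<in> S') v)"
  using assms(1)
proof induction
  case (refl w)
  then show ?case by (intro pres_eq.refl) auto
next
  case (cancel x b)
  then show ?case using pres_eq.cancel[of x S' R' b] by (auto intro: pres_eq.refl)
qed (auto intro: pres_eq.sym pres_eq.trans pres_eq.append rel)

section \<open>Twin groups through their generators\<close>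

definition twin_class :: "nat \<Rightarrow> nat word \<Rightarrow> nat word set" where
  "twin_class m = word_class {1..m - 1} (twin_relations m)"

abbreviation twin_gen :: "nat \<Rightarrow> nat \<Rightarrow> nat word set" where
  "twin_gen m i \<equiv> twin_class m [gen i]"

lemma group_twin_group: "group (twin_group m)"
  unfolding twin_group_def by (rule group_presented_group)

lemma twin_class_eq_iff:
  "u \<in> words_on {1..m - 1} \<Longrightarrow>
   twin_class m u = twin_class m v \<longleftrightarrow> pres_eq {1..m - 1} (twin_relations m) u v"
  unfolding twin_class_def by (rule word_class_eq_iff)

lemma twin_class_in_carrier:
  "u \<in> words_on {1..m - 1} \<Longrightarrow> twin_class m u \<in> carrier (twin_group m)"
  unfolding twin_group_def twin_class_def by (rule word_class_in_carrier)

lemma twin_class_append: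
  "u \<in> words_on {1..m - 1} \<Longrightarrow> v \<in> words_on {1..m - 1} \<Longrightarrow>
   twin_class m (u @ v) = twin_class m u \<otimes>\<^bsub>twin_group m\<^esub> twin_class m v"
  unfolding twin_group_def twin_class_def by (rule word_class_append)

lemma twin_class_pair:
  "i \<in> {1..m - 1} \<Longrightarrow> j \<in> {1..m - 1} \<Longrightarrow>
   twin_class m [gen i, gen j] = twin_gen m i \<otimes>\<^bsub>twin_group m\<^esub> twin_gen m j"
  unfolding twin_group_def twin_class_def by (rule word_class_pair) simp_all

lemma twin_class_Nil: "twin_class m [] = \<one>\<^bsub>twin_group m\<^esub>"
  unfolding twin_group_def twin_class_def by (rule word_class_Nil)

lemma twin_class_cases:
  assumes "X \<in> carrier (twin_group m)"
  obtains u where "u \<in> words_on {1..m - 1}" "X = twin_class m u"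
  using assms unfolding twin_group_def twin_class_def word_class_def
  by (rule presented_group_carrierE)

lemma twin_gen_in_carrier: "i \<in> {1..m - 1} \<Longrightarrow> twin_gen m i \<in> carrier (twin_group m)"
  by (rule twin_class_in_carrier) simp

lemma twin_gen_square:
  assumes "i \<in> {1..m - 1}"
  shows "twin_gen m i \<otimes>\<^bsub>twin_group m\<^esub> twin_gen m i = \<one>\<^bsub>twin_group m\<^esub>"
proof -
  have "twin_class m [gen i, gen i] = twin_class m []"
    using assms by (simp add: twin_class_eq_iff pres_eq.relation twin_relations_def)
  then show ?thesis
    using assms by (simp add: twin_class_Nil flip: twin_class_pair)
qed

lemma twin_gen_commute:
  assumes "i \<in> {1..m - 1}" "j \<in> {1..m - 1}" "\<bar>int i - int j\<bar> \<ge> 2"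
  shows "twin_gen m i \<otimes>\<^bsub>twin_group m\<^esub> twin_gen m j = twin_gen m j \<otimes>\<^bsub>twin_group m\<^esub> twin_gen m i"
proof -
  have "pres_eq {1..m - 1} (twin_relations m) [gen i, gen j] [gen j, gen i]"
    using assms by (intro pres_eq.relation) (auto simp: twin_relations_def)
  then have "twin_class m [gen i, gen j] = twin_class m [gen j, gen i]"
    using assms by (simp add: twin_class_eq_iff)
  then show ?thesis
    using assms by (simp flip: twin_class_pair)
qed

lemma twin_group_hom_eqI:
  assumes "group G" "\<phi> \<in> hom (twin_group m) G" "\<psi> \<in> hom (twin_group m) G"
    and "\<And>i. i \<in> {1..m - 1} \<Longrightarrow> \<phi> (twin_gen m i) = \<psi> (twin_gen m i)"
    and "X \<in> carrier (twin_group m)"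
  shows "\<phi> X = \<psi> X"
  using presented_group_hom_eqI[of G \<phi> "{1..m - 1}" "twin_relations m" \<psi> X] assms
  unfolding twin_group_def twin_class_def by blast

text \<open>Far commutativity is requested for \<open>i + 2 \<le> j\<close> only; the opposite order
  follows by exchanging \<open>i\<close> and \<open>j\<close>.\<close>

lemma twin_group_universal:
  assumes "group G" "\<And>i. i \<in> {1..m - 1} \<Longrightarrow> h i \<in> carrier G"
    and "\<And>i. i \<in> {1..m - 1} \<Longrightarrow> h i \<otimes>\<^bsub>G\<^esub> h i = \<one>\<^bsub>G\<^esub>"
    and "\<And>i j. i \<in> {1..m - 1} \<Longrightarrow> j \<in> {1..m - 1} \<Longrightarrow> i + 2 \<le> j \<Longrightarrow>
      h i \<otimes>\<^bsub>G\<^esub> h j = h j \<otimes>\<^bsub>G\<^esub> h i"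
  obtains \<phi> where "\<phi> \<in> hom (twin_group m) G"
    and "\<And>i. i \<in> {1..m - 1} \<Longrightarrow> \<phi> (twin_gen m i) = h i"
proof -
  interpret group G by fact
  have h: "h \<in> {1..m - 1} \<rightarrow> carrier G"
    using assms(2) by blast
  have comm: "h i \<otimes>\<^bsub>G\<^esub> h j = h j \<otimes>\<^bsub>G\<^esub> h i"
    if "i \<in> {1..m - 1}" "j \<in> {1..m - 1}" "\<bar>int i - int j\<bar> \<ge> 2" for i j
  proof (cases "i + 2 \<le> j")
    case False
    with that(3) have "j + 2 \<le> i" by linarith
    then show ?thesis using assms(4)[of j i] that by simp
  qed (use assms(4) that in blast)
  have rel: "word_eval G h u = word_eval G h v" if "(u, v) \<in> twin_relations m" for u v
    using that assms(2,3) comm unfolding twin_relations_def by auto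
  show thesis
    using presented_group_universal[OF h rel] that unfolding twin_group_def twin_class_def by blast
qed

section \<open>The standard maps between twin groups\<close>

lemma twin_relations_mono: "k \<le> m \<Longrightarrow> twin_relations k \<subseteq> twin_relations m"
  unfolding twin_relations_def by fastforce

text \<open>Representatives that are equal in the smaller group stay equal in the larger one, and
  \<open>u\<close> itself is among them.\<close>

lemma twin_incl_twin_class:
  assumes "k \<le> m" "u \<in> words_on {1..k - 1}"
  shows "twin_incl m (twin_class k u) = twin_class m u"
proof -
  have "pres_eq {1..m - 1} (twin_relations m) u v"
    if "pres_eq {1..k - 1} (twin_relations k) u v" for v
    using assms(1) by (intro pres_eq_mono[OF that _ twin_relations_mono]) auto
  then show ?thesis
    unfolding twin_incl_def twin_class_def word_class_def using pres_eq.refl[OF assms(2)]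
    by (blast intro: pres_eq.trans)
qed

lemma twin_incl_mon:
  assumes "k \<le> m"
  shows "twin_incl m \<in> mon (twin_group k) (twin_group m)"
proof -
  have sub: "u \<in> words_on {1..m - 1}" if "u \<in> words_on {1..k - 1}" for u :: "nat word"
    using that assms by (intro subsetD[OF words_on_mono that]) auto
  have "twin_incl m \<in> hom (twin_group k) (twin_group m)"
  proof (rule homI)
    fix X assume "X \<in> carrier (twin_group k)"
    then obtain u where u: "u \<in> words_on {1..k - 1}" "X = twin_class k u"
      by (rule twin_class_cases)
    then show "twin_incl m X \<in> carrier (twin_group m)"
      using twin_class_in_carrier[OF sub] assms by (simp add: twin_incl_twin_class)
    fix Y assume "Y \<in> carrier (twin_group k)"
    then obtain v where v: "v \<in> words_on {1..k - 1}" "Y = twin_class k v"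
      by (rule twin_class_cases)
    have uv: "u @ v \<in> words_on {1..k - 1}"
      using u v by simp
    have "X \<otimes>\<^bsub>twin_group k\<^esub> Y = twin_class k (u @ v)"
      unfolding u(2) v(2) twin_class_append[OF u(1) v(1)] ..
    then have "twin_incl m (X \<otimes>\<^bsub>twin_group k\<^esub> Y) = twin_class m (u @ v)"
      using twin_incl_twin_class[OF assms uv] by (simp only:)
    then show "twin_incl m (X \<otimes>\<^bsub>twin_group k\<^esub> Y) = twin_incl m X \<otimes>\<^bsub>twin_group m\<^esub> twin_incl m Y"
      unfolding u(2) v(2) twin_incl_twin_class[OF assms u(1)] twin_incl_twin_class[OF assms v(1)]
        twin_class_append[OF sub[OF u(1)] sub[OF v(1)]] .
  qed
  moreover have "inj_on (twin_incl m) (carrier (twin_group k))"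
  proof (rule inj_onI)
    fix X Y assume "X \<in> carrier (twin_group k)" "Y \<in> carrier (twin_group k)"
      and eq: "twin_incl m X = twin_incl m Y"
    then obtain u v where u: "u \<in> words_on {1..k - 1}" "X = twin_class k u"
      and v: "v \<in> words_on {1..k - 1}" "Y = twin_class k v"
      by (metis twin_class_cases)
    \<comment> \<open>The retraction on words: it fixes \<open>u\<close> and \<open>v\<close> and
      deletes the generators of index at least \<open>k\<close>.\<close>
    let ?keep = "filter (\<lambda>l. fst l \<in> {1..k - 1}) :: nat word \<Rightarrow> nat word"
    have "pres_eq {1..m - 1} (twin_relations m) u v"
      using eq u v assms sub by (simp add: twin_incl_twin_class twin_class_eq_iff)
    then have "pres_eq {1..k - 1} (twin_relations k) (?keep u) (?keep v)"
    proof (rule pres_eq_filter)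
      fix u v :: "nat word" assume "(u, v) \<in> twin_relations m"
      then consider i where "u = [gen i, gen i]" "v = []"
        | i j where "u = [gen i, gen j]" "v = [gen j, gen i]" "\<bar>int i - int j\<bar> \<ge> 2"
        by (auto simp: twin_relations_def)
      then show "pres_eq {1..k - 1} (twin_relations k) (?keep u) (?keep v)"
      proof cases
        case 1
        then show ?thesis
          by (auto intro!: pres_eq.relation pres_eq.refl simp: twin_relations_def)
      next
        case (2 i j)
        \<comment> \<open>If at least one of the two letters is deleted, both sides become the same
          word of length at most 1.\<close>
        show ?thesis
        proof (cases "i \<in> {1..k - 1} \<and> j \<in> {1..k - 1}")
          case True
          with 2 show ?thesis
            by (auto intro!: pres_eq.relation simp: twin_relations_def)
        qed (use 2 in \<open>auto intro!: pres_eq.refl\<close>)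
      qed
    qed
    moreover have "?keep u = u" "?keep v = v"
      using u v by (auto simp: filter_id_conv lists_eq_set)
    ultimately show "X = Y"
      using u v by (simp add: twin_class_eq_iff)
  qed
  ultimately show ?thesis
    by (simp add: mon_def)
qed

lemma twin_incl_twin_gen:
  "k \<le> m \<Longrightarrow> i \<in> {1..k - 1} \<Longrightarrow> twin_incl m (twin_gen k i) = twin_gen m i"
  by (rule twin_incl_twin_class) auto

text \<open>Used for the compatibility over the amalgamated subgroup, which reaches
  \<open>twin_group n\<close> directly and through \<open>twin_group (n - 2)\<close>.\<close>

lemma twin_incl_twin_incl:
  assumes "k \<le> l" "l \<le> m" "X \<in> carrier (twin_group k)"
  shows "twin_incl m (twin_incl l X) = twin_incl m X"
proof -
  obtain u where u: "u \<in> words_on {1..k - 1}" "X = twin_class k u"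
    using assms(3) by (rule twin_class_cases)
  moreover from u(1) have "u \<in> words_on {1..l - 1}"
    using assms(1) by (elim subsetD[OF words_on_mono, rotated]) auto
  ultimately show ?thesis
    using assms by (simp add: twin_incl_twin_class)
qed

text \<open>The generators of \<open>twin_group k\<close> have index at most \<open>k - 1\<close>,
  which is at distance at least 2 from \<open>i\<close>.\<close>

lemma twin_gen_incl_commute:
  assumes "k < i" "i < m" "X \<in> carrier (twin_group k)"
  shows "twin_gen m i \<otimes>\<^bsub>twin_group m\<^esub> twin_incl m X = twin_incl m X \<otimes>\<^bsub>twin_group m\<^esub> twin_gen m i"
proof -
  have km: "k \<le> m" using assms by simp
  have "twin_gen m i \<otimes>\<^bsub>twin_group m\<^esub> twin_incl m (twin_gen k j)
      = twin_incl m (twin_gen k j) \<otimes>\<^bsub>twin_group m\<^esub> twin_gen m i" if "j \<in> {1..k - 1}" for j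
    unfolding twin_incl_twin_gen[OF km that] using that assms by (intro twin_gen_commute) auto
  moreover have "twin_gen m i \<in> carrier (twin_group m)"
    using assms by (intro twin_gen_in_carrier) auto
  moreover have "twin_incl m \<in> hom (twin_group k) (twin_group m)"
    using twin_incl_mon[OF km] by (simp add: mon_def)
  ultimately show ?thesis
    using assms(3) presented_group_hom_commute[OF group_twin_group, of "twin_incl m" "{1..k - 1}"
        "twin_relations k" m "twin_gen m i" X]
    unfolding twin_group_def[of k] twin_class_def[of k] by blast
qed

section \<open>Mutually inverse homomorphisms between the twin group and the amalgamated
  product\<close>

theorem theorem2p3:
  fixes n :: nat
  assumes "n > 4"
  defines "A \<equiv> Z2 \<times>\<times> twin_group (n - 2)"
    and "B \<equiv> Z2 \<times>\<times> twin_group (n - 3)"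
    and "C \<equiv> twin_group (n - 3)"
    and "f \<equiv> (\<lambda>c. (\<one>\<^bsub>Z2\<^esub>, twin_incl (n - 2) c))"
    and "g \<equiv> (\<lambda>c. (\<one>\<^bsub>Z2\<^esub>, c))"
  shows "f \<in> mon C A \<and> g \<in> mon C B \<and> twin_group n \<cong> amalgamated_product A B C f g"
proof -
  have Z2: "carrier Z2 = {0, 1}" "\<one>\<^bsub>Z2\<^esub> = 0" "(0::int) \<otimes>\<^bsub>Z2\<^esub> 0 = 0" "(1::int) \<otimes>\<^bsub>Z2\<^esub> 1 = 0"
      "(0::int) \<otimes>\<^bsub>Z2\<^esub> 1 = 1" "(1::int) \<otimes>\<^bsub>Z2\<^esub> 0 = 1"
    by (auto simp: carrier_integer_mod_group mult_integer_mod_group)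
  have "group A" "group B"
    unfolding A_def B_def by (intro DirProd_group group_twin_group group_integer_mod_group)+
  interpret T: group "twin_group n" by (rule group_twin_group)
  interpret T2: group "twin_group (n - 2)" by (rule group_twin_group)
  interpret T3: group "twin_group (n - 3)" by (rule group_twin_group)
  interpret A: group A by fact
  interpret B: group B by fact
  \<comment> \<open>Both amalgamation maps have this form: \<open>h\<close> is the standard map for
    \<open>f\<close> and the identity for \<open>g\<close>.\<close>
  have pair_mon: "(\<lambda>x. (0, h x)) \<in> mon K (Z2 \<times>\<times> H)"
    if "h \<in> mon K H" for h and K H :: "nat word set monoid"
    using that by (auto simp: mon_def hom_def Z2 inj_on_def)
  have f_mon: "f \<in> mon C A"
    using pair_mon[OF twin_incl_mon[of "n - 3" "n - 2"]] by (simp add: f_def C_def A_def)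
  have g_mon: "g \<in> mon C B"
    using pair_mon[of "\<lambda>x. x" "twin_group (n - 3)" "twin_group (n - 3)"]
    by (simp add: g_def C_def B_def mon_def hom_def)
  interpret amalgam A B C f g
    using f_mon g_mon by unfold_locales (auto simp: mon_def)
  interpret D: group D by (rule group_D)
  interpret inl: group_hom A D inl using inl_hom by unfold_locales
  interpret inr: group_hom B D inr using inr_hom by unfold_locales

  let ?incl = "twin_incl n"
  \<comment> \<open>The factor \<open>Z2\<close> is sent to the generator of index
    \<open>n - 1\<close> by \<open>\<alpha>\<close> and of index \<open>n - 2\<close> by
    \<open>\<beta>\<close>. These indices exceed \<open>n - 2\<close> and \<open>n - 3\<close>
    respectively, so \<open>twin_gen_incl_commute\<close> supplies the commutation that
    \<open>hom_Z2_DirProd\<close> asks for.\<close>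
  define \<alpha> where "\<alpha> = (\<lambda>(a::int, x). (if a = 0 then \<one>\<^bsub>twin_group n\<^esub> else twin_gen n (n - 1))
      \<otimes>\<^bsub>twin_group n\<^esub> ?incl x)"
  define \<beta> where "\<beta> = (\<lambda>(a::int, x). (if a = 0 then \<one>\<^bsub>twin_group n\<^esub> else twin_gen n (n - 2))
      \<otimes>\<^bsub>twin_group n\<^esub> ?incl x)"
  have incl: "?incl \<in> hom (twin_group (n - 2)) (twin_group n)"
      "?incl \<in> hom (twin_group (n - 3)) (twin_group n)"
    using twin_incl_mon[of _ n] by (auto simp: mon_def)
  have \<alpha>: "\<alpha> \<in> hom A (twin_group n)"
    unfolding \<alpha>_def A_def using \<open>n > 4\<close> incl
    by (intro T.hom_Z2_DirProd twin_gen_in_carrier twin_gen_square twin_gen_incl_commute) auto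
  have \<beta>: "\<beta> \<in> hom B (twin_group n)"
    unfolding \<beta>_def B_def using \<open>n > 4\<close> incl
    by (intro T.hom_Z2_DirProd twin_gen_in_carrier twin_gen_square twin_gen_incl_commute) auto
  have "\<alpha> (f c) = \<beta> (g c)" if "c \<in> carrier C" for c
    using that twin_incl_twin_incl[of "n - 3" "n - 2" n c]
    by (simp add: \<alpha>_def \<beta>_def f_def g_def Z2 C_def)
  with universal[OF group_twin_group \<alpha> \<beta>] obtain \<psi> where \<psi>: "\<psi> \<in> hom D (twin_group n)"
    and \<psi>_inl: "\<And>a. a \<in> carrier A \<Longrightarrow> \<psi> (inl a) = \<alpha> a"
    and \<psi>_inr: "\<And>b. b \<in> carrier B \<Longrightarrow> \<psi> (inr b) = \<beta> b"
    by blast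

  \<comment> \<open>Candidates for the images of the generators of \<open>twin_group n\<close>:
    \<open>p\<close> and \<open>q\<close> generate the copies of \<open>Z2\<close> in
    \<open>A\<close> and in \<open>B\<close>.\<close>
  define s where "s i = (0::int, twin_gen (n - 2) i)" for i
  define p where "p = (1::int, \<one>\<^bsub>twin_group (n - 2)\<^esub>)"
  define q where "q = (1::int, \<one>\<^bsub>twin_group (n - 3)\<^esub>)"
  have gen2: "twin_gen (n - 2) i \<in> carrier (twin_group (n - 2))" if "i \<in> {1..n - 3}" for i
    using that by (intro twin_gen_in_carrier) auto
  have gen3: "twin_gen (n - 3) i \<in> carrier (twin_group (n - 3))" if "i \<in> {1..n - 4}" for i
    using that by (intro twin_gen_in_carrier) auto
  have s: "s i \<in> carrier A" if "i \<in> {1..n - 3}" for i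
    using gen2[OF that] by (simp add: s_def A_def Z2)
  have p: "p \<in> carrier A" and q: "q \<in> carrier B"
    by (auto simp: p_def q_def A_def B_def Z2)
  \<comment> \<open>The generators of index up to \<open>n - 4\<close> come from \<open>C\<close>,
    so they can be moved from \<open>A\<close> to \<open>B\<close>.\<close>
  have inl_s: "inl (s i) = inr (0, twin_gen (n - 3) i)" if "i \<in> {1..n - 4}" for i
    using inl_f_eq_inr_g[of "twin_gen (n - 3) i"] that gen3[OF that]
      twin_incl_twin_gen[of "n - 3" "n - 2" i]
    by (simp add: f_def g_def s_def Z2 C_def)
  have inl_comm: "inl x \<otimes>\<^bsub>D\<^esub> inl y = inl y \<otimes>\<^bsub>D\<^esub> inl x"
    if "x \<in> carrier A" "y \<in> carrier A" "x \<otimes>\<^bsub>A\<^esub> y = y \<otimes>\<^bsub>A\<^esub> x" for x y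
    using that by (simp flip: inl.hom_mult)
  have inl_sq: "inl x \<otimes>\<^bsub>D\<^esub> inl x = \<one>\<^bsub>D\<^esub>" if "x \<in> carrier A" "x \<otimes>\<^bsub>A\<^esub> x = \<one>\<^bsub>A\<^esub>" for x
    using that by (simp flip: inl.hom_mult)
  have neq: "n - 2 \<noteq> n - 1"
    using \<open>n > 4\<close> by simp
  define h where "h i = (if i = n - 1 then inl p else if i = n - 2 then inr q else inl (s i))" for i
  have hs: "h i = inl (s i)" if "i \<in> {1..n - 3}" for i
  proof -
    have "i \<noteq> n - 1" "i \<noteq> n - 2" using that \<open>n > 4\<close> by auto
    then show ?thesis by (simp add: h_def)
  qed
  have cases: "i = n - 1 \<or> i = n - 2 \<or> i \<in> {1..n - 3}" if "i \<in> {1..n - 1}" for i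
    using that by auto
  have h_in: "h i \<in> carrier D" if i: "i \<in> {1..n - 1}" for i
  proof -
    consider "i = n - 1" | "i = n - 2" | "i \<in> {1..n - 3}" using cases[OF i] by blast
    then show ?thesis using p q neq by cases (simp_all add: h_def hs s)
  qed
  have h_sq: "h i \<otimes>\<^bsub>D\<^esub> h i = \<one>\<^bsub>D\<^esub>" if i: "i \<in> {1..n - 1}" for i
  proof -
    consider "i = n - 1" | "i = n - 2" | "i \<in> {1..n - 3}" using cases[OF i] by blast
    then show ?thesis
    proof cases
      case 1
      have "p \<otimes>\<^bsub>A\<^esub> p = \<one>\<^bsub>A\<^esub>" by (simp add: p_def A_def Z2)
      then show ?thesis using 1 inl_sq[OF p] by (simp add: h_def)
    next
      case 2
      have "q \<otimes>\<^bsub>B\<^esub> q = \<one>\<^bsub>B\<^esub>" by (simp add: q_def B_def Z2)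
      then show ?thesis using 2 q neq by (simp add: h_def flip: inr.hom_mult)
    next
      case 3
      then have "s i \<otimes>\<^bsub>A\<^esub> s i = \<one>\<^bsub>A\<^esub>"
        using twin_gen_square[of i "n - 2"] by (simp add: s_def A_def Z2)
      then show ?thesis using inl_sq[OF s[OF 3]] by (simp only: hs[OF 3])
    qed
  qed
  have h_comm: "h i \<otimes>\<^bsub>D\<^esub> h j = h j \<otimes>\<^bsub>D\<^esub> h i"
    if ij: "i \<in> {1..n - 1}" "j \<in> {1..n - 1}" "i + 2 \<le> j" for i j
  proof -
    \<comment> \<open>The smaller index of a commuting pair is at most \<open>n - 3\<close>, so
      \<open>h i\<close> always comes from the first factor.\<close>
    have i: "i \<in> {1..n - 3}" using ij by auto
    then have hi: "h i = inl (s i)" by (rule hs)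
    consider "j = n - 1" | "j = n - 2" | "j \<in> {1..n - 3}" using cases[OF ij(2)] by blast
    then show ?thesis
    proof cases
      case 1
      have "s i \<otimes>\<^bsub>A\<^esub> p = p \<otimes>\<^bsub>A\<^esub> s i"
        using gen2[OF i] by (simp add: s_def p_def A_def Z2)
      then show ?thesis using inl_comm[OF s[OF i] p] hi 1 by (simp add: h_def)
    next
      case 2
      \<comment> \<open>Here \<open>i + 2 \<le> n - 2\<close> excludes \<open>i = n - 3\<close>, the
        one generator of \<open>twin_group (n - 2)\<close> missing from \<open>C\<close>; the
        relation can therefore be verified in \<open>B\<close>.\<close>
      then have i': "i \<in> {1..n - 4}" using ij by auto
      have "(0, twin_gen (n - 3) i) \<otimes>\<^bsub>B\<^esub> q = q \<otimes>\<^bsub>B\<^esub> (0, twin_gen (n - 3) i)"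
        using gen3[OF i'] by (simp add: q_def B_def Z2)
      moreover have "(0, twin_gen (n - 3) i) \<in> carrier B"
        using gen3[OF i'] by (simp add: B_def Z2)
      ultimately show ?thesis
        using 2 neq q inl_s[OF i'] hi by (simp add: h_def flip: inr.hom_mult)
    next
      case 3
      have "s i \<otimes>\<^bsub>A\<^esub> s j = s j \<otimes>\<^bsub>A\<^esub> s i"
        using twin_gen_commute[of i "n - 2" j] i 3 ij(3) by (simp add: s_def A_def Z2)
      then show ?thesis using inl_comm[OF s[OF i] s[OF 3]] by (simp only: hi hs[OF 3])
    qed
  qed
  obtain \<phi> where \<phi>: "\<phi> \<in> hom (twin_group n) D"
    and \<phi>h: "\<And>i. i \<in> {1..n - 1} \<Longrightarrow> \<phi> (twin_gen n i) = h i"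
    by (rule twin_group_universal[OF group_D, of n h])
      (assumption | rule that h_in h_sq h_comm)+
  interpret \<phi>: group_hom "twin_group n" D \<phi> using \<phi> by unfold_locales

  have incl_in: "?incl x \<in> carrier (twin_group n)"
    if "x \<in> carrier (twin_group (n - 2)) \<or> x \<in> carrier (twin_group (n - 3))" for x
    using that incl by (auto simp: hom_def)
  have pair_hom2: "(\<lambda>x. (0, x)) \<in> hom (twin_group (n - 2)) A"
    and pair_hom3: "(\<lambda>x. (0, x)) \<in> hom (twin_group (n - 3)) B"
    by (auto simp: hom_def A_def B_def Z2)
  have \<phi>_incl2: "\<phi> (?incl x) = inl (0, x)" if "x \<in> carrier (twin_group (n - 2))" for x
  proof (rule twin_group_hom_eqI[OF group_D _ _ _ that])
    show "(\<lambda>x. \<phi> (?incl x)) \<in> hom (twin_group (n - 2)) D"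
      using hom_compose[OF incl(1) \<phi>] by (simp add: comp_def)
    show "(\<lambda>x. inl (0, x)) \<in> hom (twin_group (n - 2)) D"
      using hom_compose[OF pair_hom2 inl_hom] by (simp add: comp_def)
    show "\<phi> (?incl (twin_gen (n - 2) i)) = inl (0, twin_gen (n - 2) i)"
      if i: "i \<in> {1..n - 2 - 1}" for i
    proof -
      have "i \<in> {1..n - 3}" "i \<in> {1..n - 1}" "n - 2 \<le> n" using i by auto
      then show ?thesis by (simp only: twin_incl_twin_gen[OF _ i] \<phi>h hs s_def)
    qed
  qed
  \<comment> \<open>As for \<open>twin_group (n - 2)\<close>, but \<open>h\<close> puts these
    generators into \<open>A\<close>, and \<open>inl_s\<close> carries them over to
    \<open>B\<close>.\<close>
  have \<phi>_incl3: "\<phi> (?incl x) = inr (0, x)" if "x \<in> carrier (twin_group (n - 3))" for x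
  proof (rule twin_group_hom_eqI[OF group_D _ _ _ that])
    show "(\<lambda>x. \<phi> (?incl x)) \<in> hom (twin_group (n - 3)) D"
      using hom_compose[OF incl(2) \<phi>] by (simp add: comp_def)
    show "(\<lambda>x. inr (0, x)) \<in> hom (twin_group (n - 3)) D"
      using hom_compose[OF pair_hom3 inr_hom] by (simp add: comp_def)
    show "\<phi> (?incl (twin_gen (n - 3) i)) = inr (0, twin_gen (n - 3) i)"
      if i: "i \<in> {1..n - 3 - 1}" for i
    proof -
      have "i \<in> {1..n - 4}" "i \<in> {1..n - 3}" "i \<in> {1..n - 1}" "n - 3 \<le> n" using i by auto
      then show ?thesis by (simp only: twin_incl_twin_gen[OF _ i] \<phi>h hs inl_s)
    qed
  qed
  \<comment> \<open>An element with first coordinate 1 is \<open>p\<close> times one with first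
    coordinate 0, which reduces the claim to \<open>\<phi>_incl2\<close>.\<close>
  have \<phi>\<alpha>: "\<phi> (\<alpha> a) = inl a" if a: "a \<in> carrier A" for a
  proof -
    obtain b x where ab: "a = (b, x)" by force
    have x: "x \<in> carrier (twin_group (n - 2))" and b: "b = 0 \<or> b = 1"
      using a by (auto simp: ab A_def Z2)
    have "p \<otimes>\<^bsub>A\<^esub> (0, x) = (1, x)" "(0, x) \<in> carrier A" using x by (auto simp: p_def A_def Z2)
    then have "inl p \<otimes>\<^bsub>D\<^esub> inl (0, x) = inl (1, x)" "inl (0, x) \<in> carrier D"
      using p by (simp_all flip: inl.hom_mult)
    moreover have "n - 1 \<in> {1..n - 1}" "h (n - 1) = inl p" using \<open>n > 4\<close> by (auto simp: h_def)
    ultimately show ?thesis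
      using b x incl_in by (auto simp: ab \<alpha>_def \<phi>_incl2 \<phi>h twin_gen_in_carrier)
  qed
  have \<phi>\<beta>: "\<phi> (\<beta> a) = inr a" if a: "a \<in> carrier B" for a
  proof -
    obtain b x where ab: "a = (b, x)" by force
    have x: "x \<in> carrier (twin_group (n - 3))" and b: "b = 0 \<or> b = 1"
      using a by (auto simp: ab B_def Z2)
    have "q \<otimes>\<^bsub>B\<^esub> (0, x) = (1, x)" "(0, x) \<in> carrier B" using x by (auto simp: q_def B_def Z2)
    then have "inr q \<otimes>\<^bsub>D\<^esub> inr (0, x) = inr (1, x)" "inr (0, x) \<in> carrier D"
      using q by (simp_all flip: inr.hom_mult)
    moreover have "n - 2 \<in> {1..n - 1}" "h (n - 2) = inr q" using \<open>n > 4\<close> neq by (auto simp: h_def)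
    ultimately show ?thesis
      using b x incl_in by (auto simp: ab \<beta>_def \<phi>_incl3 \<phi>h twin_gen_in_carrier)
  qed
  \<comment> \<open>On the images of the factors, \<open>\<psi>\<close> acts as
    \<open>\<alpha>\<close> and \<open>\<beta>\<close>, which \<open>\<phi>\<close> sends back to
    \<open>inl\<close> and \<open>inr\<close>.\<close>
  have \<phi>\<psi>: "\<phi> (\<psi> X) = X" if "X \<in> carrier D" for X
  proof (rule hom_eqI[OF group_D _ _ _ _ that])
    show "(\<lambda>X. \<phi> (\<psi> X)) \<in> hom D D"
      using hom_compose[OF \<psi> \<phi>] by (simp add: comp_def)
    show "(\<lambda>X. X) \<in> hom D D"
      by (simp add: hom_def)
  qed (simp_all add: \<psi>_inl \<psi>_inr \<phi>\<alpha> \<phi>\<beta>)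
  \<comment> \<open>This prepares the other composition, which by uniqueness only has to be computed
    on generators.\<close>
  have \<psi>h: "\<psi> (h i) = twin_gen n i" if i: "i \<in> {1..n - 1}" for i
  proof -
    have one: "?incl \<one>\<^bsub>twin_group (n - 2)\<^esub> = \<one>\<^bsub>twin_group n\<^esub>"
        "?incl \<one>\<^bsub>twin_group (n - 3)\<^esub> = \<one>\<^bsub>twin_group n\<^esub>"
      using hom_one[OF incl(1)] hom_one[OF incl(2)] group_twin_group by auto
    consider "i = n - 1" | "i = n - 2" | "i \<in> {1..n - 3}" using cases[OF i] by blast
    then show ?thesis
    proof cases
      case 1
      then show ?thesis using p twin_gen_in_carrier[OF i]
        by (simp add: h_def \<psi>_inl \<alpha>_def p_def one)
    next
      case 2
      then show ?thesis using q twin_gen_in_carrier[OF i] neq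
        by (simp add: h_def \<psi>_inr \<beta>_def q_def one)
    next
      case 3
      then have "h i = inl (s i)" "?incl (twin_gen (n - 2) i) = twin_gen n i"
        by (auto simp: hs twin_incl_twin_gen)
      then show ?thesis using s[OF 3] twin_gen_in_carrier[OF i]
        by (simp add: \<psi>_inl \<alpha>_def s_def)
    qed
  qed
  have \<psi>\<phi>: "\<psi> (\<phi> X) = X" if "X \<in> carrier (twin_group n)" for X
  proof (rule twin_group_hom_eqI[OF group_twin_group _ _ _ that])
    show "(\<lambda>X. \<psi> (\<phi> X)) \<in> hom (twin_group n) (twin_group n)"
      using hom_compose[OF \<phi> \<psi>] by (simp add: comp_def)
    show "(\<lambda>X. X) \<in> hom (twin_group n) (twin_group n)"
      by (simp add: hom_def)
    show "\<psi> (\<phi> (twin_gen n i)) = twin_gen n i" if "i \<in> {1..n - 1}" for i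
      by (simp only: \<phi>h[OF that] \<psi>h[OF that])
  qed
  have "bij_betw \<phi> (carrier (twin_group n)) (carrier D)"
    using \<phi> \<psi> \<phi>\<psi> \<psi>\<phi> by (intro bij_betw_byWitness[where f' = \<psi>]) (auto simp: hom_def)
  then have "twin_group n \<cong> D"
    using \<phi> unfolding is_iso_def iso_def by blast
  with f_mon g_mon show ?thesis
    by simp
qed

end
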